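(* Let $u,v$ be real numbers and $n$ a positive integer. Then $$\begin{bmatrix} u+v\\ n\end{bmatrix}=\sum_{\kappa=0}^{n}\epsilon_1^{\kappa(v-n+\kappa)}\,\epsilon_2^{(n-\kappa)(u-\kappa)}\begin{bmatrix} u\\ \kappa\end{bmatrix}\begin{bmatrix} v\\ n-\kappa\end{bmatrix}$$ or, equivalently, $$\begin{bmatrix} u+v\\ n\end{bmatrix}=\sum_{\kappa=0}^{n}\epsilon_1^{(n-\kappa)(u-\kappa)}\,\epsilon_2^{\kappa(v-n+\kappa)}\begin{bmatrix} u\\ \kappa\end{bmatrix}\begin{bmatrix} v\\ n-\kappa\end{bmatrix}.$$ (Both identities hold.)
   Context: Let $0<q<p\le 1$ be real numbers and let $\mathcal{R}$ be a meromorphic function of two variables. For real $u$ the $\mathcal{R}(p,q)$-deformed number is $[u]:=\mathcal{R}(p^u,q^u)$. Standing assumption: there are positive real numbers $\epsilon_1=\Phi_1(p,q)$, $\epsilon_2=\Phi_2(p,q)$ such that for all real $u,v$, $$[u+v]=\epsilon_1^{v}[u]+\epsilon_2^{u}[v],$$ and $[k]\neq0$ for every integer $k\ge1$. Define, for real $u$ and integer $\kappa\ge1$, the deformed factorial of $u$ of order $\kappa$ by $[u]_{\kappa}:=\prod_{v=1}^{\kappa}[u-v+1]$, with $[u]_0:=1$; the factorial $[k]!:=[1][2]\cdots[k]$, $[0]!:=1$; and the deformed binomial coefficient $\begin{bmatrix}u\\ \kappa\end{bmatrix}:=[u]_\kappa/[\kappa]!$ (all with respect to $\mathcal{R}(p,q)$).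 *)

theory Defs
  imports "HOL-Analysis.Analysis"
begin

text \<open>Complex differentiability in two variables: the (real) Frechet derivative at each point is
  complex linear. Intended for open \<open>U\<close>.\<close>

definition holomorphic2_on :: "(complex \<times> complex \<Rightarrow> complex) \<Rightarrow> (complex \<times> complex) set \<Rightarrow> bool" where
  "holomorphic2_on f U \<longleftrightarrow>
     (\<forall>z\<in>U. \<exists>a b. (f has_derivative (\<lambda>(h, k). a * h + b * k)) (at z))"

text \<open>Meromorphic functions on \<open>\<complex> \<times> \<complex>\<close>: locally a quotient of two holomorphic functions with a
  denominator that is not identically zero. Since \<open>U\<close> is connected, the zero set of \<open>g\<close> is then
  nowhere dense in \<open>U\<close>. Functions are total here, so the values on the zero set of \<open>g\<close> (poles and
  points of indeterminacy) are left unconstrained.\<close>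

definition meromorphic2 :: "(complex \<times> complex \<Rightarrow> complex) \<Rightarrow> bool" where
  "meromorphic2 R \<longleftrightarrow>
     (\<forall>z. \<exists>U f g. open U \<and> connected U \<and> z \<in> U \<and> holomorphic2_on f U \<and> holomorphic2_on g U \<and>
        (\<exists>w\<in>U. g w \<noteq> 0) \<and> (\<forall>w\<in>U. g w \<noteq> 0 \<longrightarrow> R w = f w / g w))"

definition deformed_number ::
    "(complex \<times> complex \<Rightarrow> complex) \<Rightarrow> real \<Rightarrow> real \<Rightarrow> real \<Rightarrow> complex" where
  "deformed_number R p q u = R (complex_of_real (p powr u), complex_of_real (q powr u))"

definition deformed_falling ::
    "(complex \<times> complex \<Rightarrow> complex) \<Rightarrow> real \<Rightarrow> real \<Rightarrow> real \<Rightarrow> nat \<Rightarrow> complex" where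
  "deformed_falling R p q u k = (\<Prod>v=1..k. deformed_number R p q (u - real v + 1))"

definition deformed_fact ::
    "(complex \<times> complex \<Rightarrow> complex) \<Rightarrow> real \<Rightarrow> real \<Rightarrow> nat \<Rightarrow> complex" where
  "deformed_fact R p q k = (\<Prod>j=1..k. deformed_number R p q (real j))"

definition deformed_binomial ::
    "(complex \<times> complex \<Rightarrow> complex) \<Rightarrow> real \<Rightarrow> real \<Rightarrow> real \<Rightarrow> nat \<Rightarrow> complex" where
  "deformed_binomial R p q u k = deformed_falling R p q u k / deformed_fact R p q k"

end

theory Submission
  imports Defs
begin

text \<open>
  As \<open>u + v - n = (u - k) + (v - n + k)\<close> for every \<open>k\<close>, multiplying the \<open>k\<close>-th term of order \<open>n\<close> by
  \<open>[u + v - n]\<close> contributes to the terms \<open>k\<close> and \<open>k + 1\<close> of order \<open>n + 1\<close>. Splitting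
  \<open>[n + 1] = [(n + 1 - k) + k]\<close> in the same way gives the Pascal rule that recombines these
  contributions. Exchanging the two summands in the addition rule exchanges \<open>\<epsilon>\<^sub>1\<close> and \<open>\<epsilon>\<^sub>2\<close>,
  which yields the second identity from the first.
\<close>

lemma deformed_falling_Suc:
  "deformed_falling R p q u (Suc k) = deformed_falling R p q u k * deformed_number R p q (u - real k)"
  by (simp add: deformed_falling_def)

lemma deformed_fact_Suc:
  "deformed_fact R p q (Suc k) = deformed_fact R p q k * deformed_number R p q (real (Suc k))"
  by (simp add: deformed_fact_def)

text \<open>Numerator and denominator each gain one factor. The multiplied form lets the main
  induction trade \<open>[k + 1]\<close> for \<open>[u - k]\<close> without handling
  quotients.\<close>

lemma deformed_binomial_Suc:
  assumes "deformed_number R p q (real (Suc k)) \<noteq> 0"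
  shows "deformed_number R p q (real (Suc k)) * deformed_binomial R p q u (Suc k) =
           deformed_number R p q (u - real k) * deformed_binomial R p q u k"
  using assms by (simp add: deformed_binomial_def deformed_falling_Suc deformed_fact_Suc del: of_nat_Suc)

lemma deformed_vandermonde:
  fixes a b u v :: real
  assumes a: "a > 0" and b: "b > 0"
    and add: "\<And>x y :: real. deformed_number R p q (x + y) =
           complex_of_real (a powr y) * deformed_number R p q x
         + complex_of_real (b powr x) * deformed_number R p q y"
    and nz: "\<And>k :: nat. k \<ge> 1 \<Longrightarrow> deformed_number R p q (real k) \<noteq> 0"
  shows "deformed_binomial R p q (u + v) n =
           (\<Sum>k=0..n.
              complex_of_real (a powr (real k * (v - real n + real k)))
            * complex_of_real (b powr ((real n - real k) * (u - real k)))
            * deformed_binomial R p q u k * deformed_binomial R p q v (n - k))"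
proof (induction n)
  case 0
  \<comment> \<open>Positivity matters here: \<open>x powr 0\<close> is 1 only for nonzero
    \<open>x\<close>.\<close>
  show ?case using a b by (simp add: deformed_binomial_def deformed_falling_def deformed_fact_def)
next
  case (Suc n)
  let ?f = "deformed_number R p q"
  let ?B = "deformed_binomial R p q"
  let ?A = "\<lambda>x. complex_of_real (a powr x)"
  let ?E = "\<lambda>x. complex_of_real (b powr x)"
  define t where "t n k = ?A (real k * (v - real n + real k)) * ?E ((real n - real k) * (u - real k))
            * ?B u k * ?B v (n - k)" for n k :: nat
  \<comment> \<open>The addition rule at \<open>0 + 0\<close> reads \<open>[0] = 2 [0]\<close>. This
    removes the boundary terms of both sums below.\<close>
  have f0: "?f 0 = 0"
    using add[of 0 0] a b by simp
  have A_add: "?A x * ?A y = ?A (x + y)" for x y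
    by (simp add: powr_add)
  have E_add: "?E x * ?E y = ?E (x + y)" for x y
    by (simp add: powr_add)
  have split: "?f (real (Suc n)) * t (Suc n) k =
      ?A (real k) * ?f (real (Suc n) - real k) * t (Suc n) k
    + ?E (real (Suc n) - real k) * ?f (real k) * t (Suc n) k" for k
    using add[of "real (Suc n) - real k" "real k"] by (simp add: algebra_simps)
  \<comment> \<open>The binomial of \<open>v\<close> absorbs \<open>[n + 1 - k]\<close>. The extra
    power of \<open>a\<close> restores the exponent of order \<open>n\<close>, while
    \<open>(n + 1 - k)(u - k)\<close> releases one \<open>u - k\<close>. The bound on
    \<open>k\<close> gives \<open>Suc n - k = Suc (n - k)\<close>.\<close>
  have stay: "?A (real k) * ?f (real (Suc n) - real k) * t (Suc n) k =
      ?E (u - real k) * ?f (v - real n + real k) * t n k" if "k \<le> n" for k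
  proof -
    have B: "?f (real (Suc n) - real k) * ?B v (Suc n - k) = ?f (v - real n + real k) * ?B v (n - k)"
      using deformed_binomial_Suc[of R p q "n - k" v] nz[of "Suc (n - k)"] that
      by (simp add: Suc_diff_le of_nat_diff algebra_simps)
    have "?A (real k) * ?f (real (Suc n) - real k) * t (Suc n) k =
       (?A (real k) * ?A (real k * (v - real (Suc n) + real k)))
        * ?E ((real (Suc n) - real k) * (u - real k)) * ?B u k
        * (?f (real (Suc n) - real k) * ?B v (Suc n - k))"
      by (simp add: t_def mult_ac)
    also have "\<dots> = ?A (real k * (v - real n + real k))
        * (?E (u - real k) * ?E ((real n - real k) * (u - real k))) * ?B u k
        * (?f (v - real n + real k) * ?B v (n - k))"
      unfolding A_add E_add B by (simp add: algebra_simps)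
    finally show ?thesis
      by (simp add: t_def mult_ac)
  qed
  \<comment> \<open>Here the binomial of \<open>u\<close> absorbs \<open>[k + 1]\<close>, and that
    of \<open>v\<close> is unchanged because \<open>Suc n - Suc k = n - k\<close>. Now
    \<open>(k + 1)(v - n + k)\<close> releases one \<open>v - n + k\<close>.\<close>
  have step: "?E (real (Suc n) - real (Suc k)) * ?f (real (Suc k)) * t (Suc n) (Suc k) =
      ?A (v - real n + real k) * ?f (u - real k) * t n k" for k
  proof -
    have B: "?f (real (Suc k)) * ?B u (Suc k) = ?f (u - real k) * ?B u k"
      by (intro deformed_binomial_Suc nz) simp
    have "?E (real (Suc n) - real (Suc k)) * ?f (real (Suc k)) * t (Suc n) (Suc k) =
        ?A (real (Suc k) * (v - real (Suc n) + real (Suc k)))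
        * (?E (real (Suc n) - real (Suc k)) * ?E ((real (Suc n) - real (Suc k)) * (u - real (Suc k))))
        * (?f (real (Suc k)) * ?B u (Suc k)) * ?B v (n - k)"
      by (simp add: t_def mult_ac)
    also have "\<dots> = (?A (v - real n + real k) * ?A (real k * (v - real n + real k)))
        * ?E ((real n - real k) * (u - real k)) * (?f (u - real k) * ?B u k) * ?B v (n - k)"
      unfolding A_add E_add B by (simp add: algebra_simps)
    finally show ?thesis
      by (simp add: t_def mult_ac)
  qed
  \<comment> \<open>The two coefficients are exactly those produced by \<open>stay\<close> and
    \<open>step\<close>, and their sum does not depend on \<open>k\<close>.\<close>
  have add': "?f (u + v - real n) =
      ?E (u - real k) * ?f (v - real n + real k) + ?A (v - real n + real k) * ?f (u - real k)" for k
    using add[of "u - real k" "v - real n + real k"] by (simp add: algebra_simps)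
  have "?f (real (Suc n)) * (\<Sum>k=0..Suc n. t (Suc n) k) =
      (\<Sum>k=0..Suc n. ?A (real k) * ?f (real (Suc n) - real k) * t (Suc n) k)
    + (\<Sum>k=0..Suc n. ?E (real (Suc n) - real k) * ?f (real k) * t (Suc n) k)"
    unfolding sum_distrib_left split sum.distrib ..
  \<comment> \<open>The term \<open>k = Suc n\<close> carries the factor \<open>[0]\<close>.\<close>
  also have "(\<Sum>k=0..Suc n. ?A (real k) * ?f (real (Suc n) - real k) * t (Suc n) k) =
      (\<Sum>k=0..n. ?A (real k) * ?f (real (Suc n) - real k) * t (Suc n) k)"
    by (simp add: f0)
  also have "\<dots> = (\<Sum>k=0..n. ?E (u - real k) * ?f (v - real n + real k) * t n k)"
    by (intro sum.cong refl stay) simp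
  \<comment> \<open>In this sum the term \<open>k = 0\<close> carries \<open>[0]\<close>; the rest
    is shifted by one.\<close>
  also have "(\<Sum>k=0..Suc n. ?E (real (Suc n) - real k) * ?f (real k) * t (Suc n) k) =
      (\<Sum>k=0..n. ?E (real (Suc n) - real (Suc k)) * ?f (real (Suc k)) * t (Suc n) (Suc k))"
    unfolding sum.atLeast0_atMost_Suc_shift by (simp add: f0)
  also have "\<dots> = (\<Sum>k=0..n. ?A (v - real n + real k) * ?f (u - real k) * t n k)"
    unfolding step ..
  also have "(\<Sum>k=0..n. ?E (u - real k) * ?f (v - real n + real k) * t n k) + \<dots> =
      ?f (u + v - real n) * (\<Sum>k=0..n. t n k)"
    unfolding sum_distrib_left sum.distrib[symmetric]
    by (intro sum.cong refl) (metis add' distrib_right)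
  also have "(\<Sum>k=0..n. t n k) = ?B (u + v) n"
    using Suc.IH by (simp add: t_def)
  also have "?f (u + v - real n) * ?B (u + v) n = ?f (real (Suc n)) * ?B (u + v) (Suc n)"
    by (intro deformed_binomial_Suc[symmetric] nz) simp
  finally have "(\<Sum>k=0..Suc n. t (Suc n) k) = ?B (u + v) (Suc n)"
    using nz[of "Suc n"] by simp
  then show ?case
    unfolding t_def by simp
qed

theorem theorem3p13:
  fixes R :: "complex \<times> complex \<Rightarrow> complex"
    and p q eps1 eps2 u v :: real
    and n :: nat
  assumes "0 < q" and "q < p" and "p \<le> 1"
    and "meromorphic2 R"
    and "eps1 > 0" and "eps2 > 0"
    and "\<And>x y :: real. deformed_number R p q (x + y) =
           complex_of_real (eps1 powr y) * deformed_number R p q x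
         + complex_of_real (eps2 powr x) * deformed_number R p q y"
    and "\<And>k :: nat. k \<ge> 1 \<Longrightarrow> deformed_number R p q (real k) \<noteq> 0"
    and "n \<ge> 1"
  shows "deformed_binomial R p q (u + v) n =
           (\<Sum>k=0..n.
              complex_of_real (eps1 powr (real k * (v - real n + real k)))
            * complex_of_real (eps2 powr ((real n - real k) * (u - real k)))
            * deformed_binomial R p q u k * deformed_binomial R p q v (n - k))
       \<and> deformed_binomial R p q (u + v) n =
           (\<Sum>k=0..n.
              complex_of_real (eps1 powr ((real n - real k) * (u - real k)))
            * complex_of_real (eps2 powr (real k * (v - real n + real k)))
            * deformed_binomial R p q u k * deformed_binomial R p q v (n - k))"
proof
  note add = assms(7)
  have add_swapped: "deformed_number R p q (x + y) =
           complex_of_real (eps2 powr y) * deformed_number R p q x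
         + complex_of_real (eps1 powr x) * deformed_number R p q y" for x y
    using add[of y x] by (simp add: add.commute)
  show "deformed_binomial R p q (u + v) n =
           (\<Sum>k=0..n.
              complex_of_real (eps1 powr (real k * (v - real n + real k)))
            * complex_of_real (eps2 powr ((real n - real k) * (u - real k)))
            * deformed_binomial R p q u k * deformed_binomial R p q v (n - k))"
    by (rule deformed_vandermonde[OF assms(5,6) add assms(8)])
  show "deformed_binomial R p q (u + v) n =
           (\<Sum>k=0..n.
              complex_of_real (eps1 powr ((real n - real k) * (u - real k)))
            * complex_of_real (eps2 powr (real k * (v - real n + real k)))
            * deformed_binomial R p q u k * deformed_binomial R p q v (n - k))"
    \<comment> \<open>Only the bases trade places; \<open>u\<close> and \<open>v\<close> keep their
      roles.\<close>
    using deformed_vandermonde[OF assms(6,5) add_swapped assms(8), of u v n]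
    by (simp add: mult_ac)
qed

end
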